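(* Let $I\subset\mathbb{N}$ be a finite index set, let $X_i$ ($i\in I$) be real random variables, all continuous with probability density functions $f_{X_i}$ or all discrete with probability mass functions $f_{X_i}$, and let $A_i\in\mathbb{R}$ ($i\in I$) with $\sum_{i\in I}A_i=1$. Let $Y$ be a random variable (of the same type) whose density (respectively mass function) is $$f_Y(t)=\sum_{i\in I}A_i f_{X_i}(t).$$ Then the reliability function of $Y$ is, for all $t\in\mathbb{R}$, $$R_Y(t)=\sum_{i\in I}A_iR_{X_i}(t).$$
   Context: The reliability function of a real random variable $X$ is $R_X(t)=P(X>t)$, i.e. $\int_t^\infty f_X(s)\,ds$ in the continuous case and $\sum_{x>t}f_X(x)$ in the discrete case. "PDF" means probability density function in the continuous case and probability mass function in the discrete case. The coefficients $A_i$ may be negative. *)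

theory Defs
  imports "HOL-Probability.Probability"
begin

definition reliability :: "'a measure \<Rightarrow> ('a \<Rightarrow> real) \<Rightarrow> real \<Rightarrow> real" where
  "reliability M X t = measure M {\<omega> \<in> space M. X \<omega> > t}"

(* The nonnegativity conjunct is needed because ennreal truncates negative values to 0:
   without it, a combination with negative coefficients that is negative on a set of
   positive measure could count as a density. *)
definition has_pdf :: "'a measure \<Rightarrow> ('a \<Rightarrow> real) \<Rightarrow> (real \<Rightarrow> real) \<Rightarrow> bool" where
  "has_pdf M X f \<longleftrightarrow> (\<forall>t. 0 \<le> f t) \<and> distributed M lborel X (\<lambda>t. ennreal (f t))"

(* Discreteness means that X takes values in some countable set almost surely; the support
   may be infinite, so simple_distributed, which requires a finite range, does not apply. *)
definition has_pmf :: "'a measure \<Rightarrow> ('a \<Rightarrow> real) \<Rightarrow> (real \<Rightarrow> real) \<Rightarrow> bool" where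
  "has_pmf M X f \<longleftrightarrow>
     X \<in> borel_measurable M \<and>
     (\<exists>S. countable S \<and> (AE \<omega> in M. X \<omega> \<in> S)) \<and>
     (\<forall>t. f t = measure M {\<omega> \<in> space M. X \<omega> = t})"

end

theory Submission
  imports Defs
begin

text \<open>The reliability function at t is the Bochner integral of the density over the half-line
  above t, with respect to Lebesgue measure in the continuous case and counting measure in the
  discrete case. Each of these integrals converges, so negative coefficients are harmless and the
  claim is linearity of the integral.\<close>

text \<open>The integrand is nonnegative, so its Bochner integral can be read off from its
  nonnegative integral as soon as the latter is a real number. Here that number is the probability
  of the half-line under the law of \<open>X\<close>.\<close>

lemma has_bochner_integral_pdf:
  assumes "prob_space M" and pdf: "has_pdf M X f"
  shows "has_bochner_integral lborel (\<lambda>s. indicator {t<..} s * f s) (reliability M X t)"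
proof (rule has_bochner_integral_nn_integral)
  interpret prob_space M by fact
  have nonneg: "0 \<le> f s" for s
    using pdf by (simp add: has_pdf_def)
  have dist: "distributed M lborel X (\<lambda>s. ennreal (f s))"
    using pdf by (simp add: has_pdf_def)
  have [measurable]: "f \<in> borel_measurable lborel"
    using distributed_real_measurable[OF nonneg dist] .
  show "(\<lambda>s. indicator {t<..} s * f s) \<in> borel_measurable lborel"
    by measurable
  show "AE s in lborel. 0 \<le> indicator {t<..} s * f s"
    by (simp add: nonneg)
  show "0 \<le> reliability M X t"
    by (simp add: reliability_def)
  have "emeasure M (X -` {t<..} \<inter> space M) = (\<integral>\<^sup>+s. ennreal (f s) * indicator {t<..} s \<partial>lborel)"
    by (rule distributed_emeasure[OF dist]) simp
  moreover have "X -` {t<..} \<inter> space M = {\<omega> \<in> space M. X \<omega> > t}"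
    by auto
  \<comment> \<open>Nonnegativity of \<open>f\<close> lets \<open>ennreal\<close> pass through the
    product, and finiteness of \<open>M\<close> turns \<open>emeasure\<close> into
    \<open>ennreal\<close> of a real probability.\<close>
  ultimately show "(\<integral>\<^sup>+s. ennreal (indicator {t<..} s * f s) \<partial>lborel) = ennreal (reliability M X t)"
    by (simp add: reliability_def emeasure_eq_measure nonneg ennreal_mult' ennreal_indicator mult.commute)
qed

text \<open>Almost all mass sits on a countable set \<open>S\<close>, so the integral over the
  uncountable counting space reduces to a countable sum over the part of \<open>S\<close> above
  \<open>t\<close>, where countable additivity applies.\<close>

lemma has_bochner_integral_pmf:
  assumes "prob_space M" and pmf: "has_pmf M X f"
  shows "has_bochner_integral (count_space UNIV) (\<lambda>s. indicator {t<..} s * f s) (reliability M X t)"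
proof (rule has_bochner_integral_nn_integral)
  interpret prob_space M by fact
  have [measurable]: "X \<in> borel_measurable M" and f: "\<And>s. f s = prob {\<omega> \<in> space M. X \<omega> = s}"
    using pmf by (auto simp: has_pmf_def)
  obtain S where S: "countable S" "AE \<omega> in M. X \<omega> \<in> S"
    using pmf by (auto simp: has_pmf_def)
  have nonneg: "0 \<le> f s" for s
    by (simp add: f)
  show "(\<lambda>s. indicator {t<..} s * f s) \<in> borel_measurable (count_space UNIV)"
    by simp
  show "AE s in count_space UNIV. 0 \<le> indicator {t<..} s * f s"
    by (simp add: nonneg)
  show "0 \<le> reliability M X t"
    by (simp add: reliability_def)
  \<comment> \<open>A point outside \<open>S\<close> is almost surely missed by \<open>X\<close>.
    This is what permits cutting the integral down to \<open>?T\<close> below.\<close>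
  have outside: "f s = 0" if "s \<notin> S" for s
  proof -
    have "AE \<omega> in M. X \<omega> \<noteq> s"
      using S(2) by eventually_elim (use that in auto)
    then show ?thesis
      unfolding f by (subst prob_eq_0) auto
  qed
  \<comment> \<open>In the law of \<open>X\<close> on the Borel sets every singleton is measurable,
    so the measure of the countable set \<open>?T\<close> is the sum of its point masses.\<close>
  let ?P = "distr M borel X" and ?T = "S \<inter> {t<..}"
  have T: "countable ?T"
    using S(1) by blast
  then have [measurable]: "?T \<in> sets borel"
    by (rule sets.countable[rotated]) simp
  have singleton: "emeasure ?P {s} = ennreal (f s)" for s
    by (subst emeasure_distr) (auto simp: f emeasure_eq_measure intro!: arg_cong[where f=prob])
  have "(\<integral>\<^sup>+s. ennreal (indicator {t<..} s * f s) \<partial>count_space UNIV) =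
      (\<integral>\<^sup>+s. ennreal (f s) * indicator ?T s \<partial>count_space UNIV)"
    by (intro nn_integral_cong) (auto simp: outside split: split_indicator)
  also have "\<dots> = (\<integral>\<^sup>+s. ennreal (f s) \<partial>count_space ?T)"
    by (simp add: nn_integral_count_space_indicator)
  also have "\<dots> = emeasure ?P ?T"
    using T by (subst emeasure_countable_singleton) (auto simp: singleton)
  also have "\<dots> = emeasure M {\<omega> \<in> space M. X \<omega> \<in> ?T}"
    by (subst emeasure_distr) (auto intro!: arg_cong[where f="emeasure M"])
  \<comment> \<open>The two events differ only where \<open>X\<close> leaves \<open>S\<close>, which
    is a null set.\<close>
  also have "\<dots> = emeasure M {\<omega> \<in> space M. X \<omega> > t}"
  proof (rule emeasure_eq_AE)
    show "AE \<omega> in M. \<omega> \<in> {\<omega> \<in> space M. X \<omega> \<in> ?T} \<longleftrightarrow> \<omega> \<in> {\<omega> \<in> space M. X \<omega> > t}"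
      using S(2) by eventually_elim auto
  qed measurable
  finally show "(\<integral>\<^sup>+s. ennreal (indicator {t<..} s * f s) \<partial>count_space UNIV) = ennreal (reliability M X t)"
    by (simp add: reliability_def emeasure_eq_measure)
qed

theorem theorem3:
  fixes I :: "nat set" and A :: "nat \<Rightarrow> real"
    and M :: "nat \<Rightarrow> 'a measure" and X :: "nat \<Rightarrow> 'a \<Rightarrow> real" and f :: "nat \<Rightarrow> real \<Rightarrow> real"
    and N :: "'b measure" and Y :: "'b \<Rightarrow> real" and f\<^sub>Y :: "real \<Rightarrow> real"
  assumes "finite I"
    and "\<And>i. i \<in> I \<Longrightarrow> prob_space (M i)"
    and "prob_space N"
    and "(\<Sum>i\<in>I. A i) = 1"
    and "\<And>t. f\<^sub>Y t = (\<Sum>i\<in>I. A i * f i t)"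
    and "((\<forall>i\<in>I. has_pdf (M i) (X i) (f i)) \<and> has_pdf N Y f\<^sub>Y) \<or>
         ((\<forall>i\<in>I. has_pmf (M i) (X i) (f i)) \<and> has_pmf N Y f\<^sub>Y)"
  shows "\<forall>t. reliability N Y t = (\<Sum>i\<in>I. A i * reliability (M i) (X i) t)"
proof
  fix t
  \<comment> \<open>Keeping \<open>K\<close> arbitrary lets one argument serve both Lebesgue and
    counting measure. The Bochner integral, unlike the nonnegative one, is linear for coefficients
    of either sign.\<close>
  have linear: "reliability N Y t = (\<Sum>i\<in>I. A i * reliability (M i) (X i) t)"
    if X: "\<And>i. i \<in> I \<Longrightarrow>
        has_bochner_integral K (\<lambda>s. indicator {t<..} s * f i s) (reliability (M i) (X i) t)"
      and Y: "has_bochner_integral K (\<lambda>s. indicator {t<..} s * f\<^sub>Y s) (reliability N Y t)"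
    for K :: "real measure"
  proof -
    have "has_bochner_integral K (\<lambda>s. \<Sum>i\<in>I. A i * (indicator {t<..} s * f i s))
        (\<Sum>i\<in>I. A i * reliability (M i) (X i) t)"
      by (intro has_bochner_integral_sum has_bochner_integral_mult_right X)
    moreover have "(\<lambda>s. \<Sum>i\<in>I. A i * (indicator {t<..} s * f i s)) = (\<lambda>s. indicator {t<..} s * f\<^sub>Y s)"
      by (simp add: assms(5) sum_distrib_left mult.left_commute)
    \<comment> \<open>The same function has both values as its integral, and the value of a Bochner
      integral is unique.\<close>
    ultimately show ?thesis
      using Y by (metis has_bochner_integral_eq)
  qed
  from assms(6) show "reliability N Y t = (\<Sum>i\<in>I. A i * reliability (M i) (X i) t)"
  proof (elim disjE conjE)
    assume "\<forall>i\<in>I. has_pdf (M i) (X i) (f i)" "has_pdf N Y f\<^sub>Y"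
    then show ?thesis
      using assms(2,3) by (intro linear[of lborel] has_bochner_integral_pdf) auto
  next
    assume "\<forall>i\<in>I. has_pmf (M i) (X i) (f i)" "has_pmf N Y f\<^sub>Y"
    then show ?thesis
      using assms(2,3) by (intro linear[of "count_space UNIV"] has_bochner_integral_pmf) auto
  qed
qed

end
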